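(* Let $\mathcal{E}$ be the set of non-negative upper semicontinuous functions $f:[0,1]\to[0,\infty)$, and for $f,g\in\mathcal{E}$ let $\mathbb{H}(f,g)=d_H(H_f,H_g)$ be the Hausdorff distance between their hypographs. Then: (a) The metric space $(\mathcal{E},\mathbb{H})$ is complete and separable. Also, any bounded and closed set in $(\mathcal{E},\mathbb{H})$ is compact. In particular, $(\mathcal{E},\mathbb{H})$ is locally compact. (b) If $f\in\mathcal{E}$ and $(f_n)_{n\ge 1}$ is a sequence in $\mathcal{E}$ such that $\mathbb{H}(f_n,f)\to 0$ as $n\to\infty$, then $$\max_{x\in[0,1]} f(x)=\lim_{n\to+\infty}\ \max_{x\in[0,1]} f_n(x).$$
   Context: A function $f:[0,1]\to\mathbb{R}$ is upper semicontinuous (USC) if $\limsup_{x\to x_0} f(x)\le f(x_0)$ for every $x_0\in[0,1]$. For a non-negative function $f$ on $[0,1]$ the hypograph is $H_f=\{(x,y)\in\mathbb{R}^2:\ x\in[0,1],\ 0\le y\le f(x)\}$; it is a non-empty compact subset of $\mathbb{R}^2$ when $f$ is USC, and a USC function attains its maximum on $[0,1]$. For non-empty compact sets $A,C\subset\mathbb{R}^2$, the Hausdorff distance is $d_H(A,C)=\max\{\max_{a\in A}d(a,C),\ \max_{c\in C}d(c,A)\}$, where $d(a,C)=\inf\{\|a-c\|:c\in C\}$ and $\|\cdot\|$ is the Euclidean norm. The function $\mathbb{H}$ is a metric on $\mathcal{E}$. *)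

theory Defs
  imports "HOL-Analysis.Analysis"
begin

text \<open>The library's \<^const>\<open>Max\<close> is only meaningful on finite sets. This is the maximum of an
  arbitrary set of reals; it is unspecified if the set has no greatest element.\<close>

definition maximum :: "real set \<Rightarrow> real" where
  "maximum A = (GREATEST m. m \<in> A)"

text \<open>The Limsup is taken in the extended reals, so that it always exists.\<close>

definition usc_on :: "real set \<Rightarrow> (real \<Rightarrow> real) \<Rightarrow> bool" where
  "usc_on S f \<longleftrightarrow>
     (\<forall>x0\<in>S. Limsup (at x0 within S) (\<lambda>x. ereal (f x)) \<le> ereal (f x0))"

text \<open>Functions \<open>[0,1] \<rightarrow> [0,\<infinity>)\<close> are elements of the extensional function space, i.e. they take
  the value \<^const>\<open>undefined\<close> off \<open>[0,1]\<close>; two of them are then equal as HOL functions iff they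
  agree on \<open>[0,1]\<close>.\<close>

definition USC :: "(real \<Rightarrow> real) set" where
  "USC = {f \<in> {0..1} \<rightarrow>\<^sub>E {0..}. usc_on {0..1} f}"

definition hypograph :: "(real \<Rightarrow> real) \<Rightarrow> (real \<times> real) set" where
  "hypograph f = {(x, y). x \<in> {0..1} \<and> 0 \<le> y \<and> y \<le> f x}"

text \<open>The value 0 on arguments that are not non-empty compact sets is a convention:
  \<^locale>\<open>Metric_space\<close> asks for a distance that is non-negative and symmetric on the whole type.\<close>

definition hausdorff_dist :: "'a::metric_space set \<Rightarrow> 'a set \<Rightarrow> real" where
  "hausdorff_dist A C =
     (if compact A \<and> A \<noteq> {} \<and> compact C \<and> C \<noteq> {}
      then max (maximum ((\<lambda>a. infdist a C) ` A)) (maximum ((\<lambda>c. infdist c A) ` C))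
      else 0)"

text \<open>The norm of \<^typ>\<open>real \<times> real\<close> is the Euclidean one (\<open>norm_Pair\<close>).\<close>

definition hypo_dist :: "(real \<Rightarrow> real) \<Rightarrow> (real \<Rightarrow> real) \<Rightarrow> real" where
  "hypo_dist f g = hausdorff_dist (hypograph f) (hypograph g)"

end

theory Submission
  imports Defs "HOL-Complex_Analysis.Great_Picard"
begin

text \<open>All of (a) follows from sequential compactness: if the functions \<open>f\<^sub>n\<close> are uniformly bounded, then
  by Blaschke's selection theorem a subsequence of their hypographs converges to a compact set
  \<open>K\<close>. The hypographs of upper semicontinuous functions are exactly the compact subsets of
  \<open>[0,1] \<times> [0,\<infinity>)\<close> that contain the base \<open>[0,1] \<times> {0}\<close> and are closed under moving down to the
  base, and \<open>K\<close> inherits these properties because the distances to the hypographs converge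
  pointwise to the distance to \<open>K\<close>. Part (b) holds since the maximum of \<open>f\<close> is the height of its
  hypograph, a 1-Lipschitz quantity.\<close>

section \<open>The Hausdorff distance\<close>

lemma maximum_eqI:
  assumes "m \<in> A" "\<And>a. a \<in> A \<Longrightarrow> a \<le> m"
  shows "maximum A = m"
  unfolding maximum_def using assms by (intro Greatest_equality) auto

lemma maximum_le_iff:
  assumes "compact A" "A \<noteq> {}"
  shows "maximum A \<le> e \<longleftrightarrow> (\<forall>a\<in>A. a \<le> e)"
proof -
  obtain m where "m \<in> A" "\<And>a. a \<in> A \<Longrightarrow> a \<le> m"
    using compact_attains_sup[OF assms] by blast
  then show ?thesis
    using maximum_eqI[of m A] by force
qed

text \<open>Both distance functions are continuous, so their images are compact and the two maxima
  are attained. Upper bounds on the distance go through this equivalence instead of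
  \<open>maximum\<close>.\<close>

lemma hausdorff_dist_le_iff:
  assumes "compact A" "A \<noteq> {}" "compact C" "C \<noteq> {}"
  shows "hausdorff_dist A C \<le> e \<longleftrightarrow>
           (\<forall>a\<in>A. infdist a C \<le> e) \<and> (\<forall>c\<in>C. infdist c A \<le> e)"
proof -
  have "compact ((\<lambda>a. infdist a C) ` A)" "compact ((\<lambda>c. infdist c A) ` C)"
    by (intro compact_continuous_image continuous_intros assms)+
  then show ?thesis
    using assms by (simp add: hausdorff_dist_def maximum_le_iff)
qed

lemma hausdorff_dist_commute: "hausdorff_dist A C = hausdorff_dist C A"
  by (auto simp: hausdorff_dist_def max.commute)

lemma infdist_le_hausdorff_dist:
  assumes "compact A" "compact C" "C \<noteq> {}" "a \<in> A"
  shows "infdist a C \<le> hausdorff_dist A C"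
  using hausdorff_dist_le_iff[of A C "hausdorff_dist A C"] assms by auto

lemma hausdorff_dist_nonneg: "0 \<le> hausdorff_dist A C"
proof (cases "compact A \<and> A \<noteq> {} \<and> compact C \<and> C \<noteq> {}")
  case True
  then obtain a where "a \<in> A" by blast
  then have "infdist a C \<le> hausdorff_dist A C"
    using True by (intro infdist_le_hausdorff_dist) auto
  then show ?thesis
    using infdist_nonneg order_trans by blast
\<comment> \<open>In the remaining case the distance has its conventional value 0.\<close>
qed (auto simp: hausdorff_dist_def)

lemma hausdorff_dist_eq_0_iff:
  assumes "compact A" "A \<noteq> {}" "compact C" "C \<noteq> {}"
  shows "hausdorff_dist A C = 0 \<longleftrightarrow> A = C"
proof
  assume "hausdorff_dist A C = 0"
  then have "\<forall>a\<in>A. infdist a C \<le> 0" "\<forall>c\<in>C. infdist c A \<le> 0"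
    using hausdorff_dist_le_iff[OF assms, of 0] by auto
  then have "\<forall>a\<in>A. infdist a C = 0" "\<forall>c\<in>C. infdist c A = 0"
    using infdist_nonneg antisym by metis+
  then show "A = C"
    using in_closed_iff_infdist_zero[OF compact_imp_closed[OF assms(1)] assms(2)]
      in_closed_iff_infdist_zero[OF compact_imp_closed[OF assms(3)] assms(4)] by blast
next
  assume "A = C"
  then have "hausdorff_dist A C \<le> 0"
    using hausdorff_dist_le_iff[OF assms, of 0] by simp
  then show "hausdorff_dist A C = 0"
    using hausdorff_dist_nonneg antisym by metis
qed

text \<open>Pass through a point of \<open>A\<close> nearest to \<open>x\<close>. The distance from
  a fixed point is thus 1-Lipschitz in the set, which yields both the triangle inequality and
  pointwise convergence of distances.\<close>

lemma infdist_le_infdist_plus_hausdorff_dist: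
  fixes x :: "'a::heine_borel"
  assumes "compact A" "A \<noteq> {}" "compact C" "C \<noteq> {}"
  shows "infdist x C \<le> infdist x A + hausdorff_dist A C"
proof -
  obtain a where a: "a \<in> A" "infdist x A = dist x a"
    using infdist_attains_inf compact_imp_closed assms by metis
  have "infdist x C \<le> infdist a C + dist x a"
    by (rule infdist_triangle)
  also have "\<dots> \<le> hausdorff_dist A C + dist x a"
    using infdist_le_hausdorff_dist assms a by simp
  finally show ?thesis using a by simp
qed

lemma hausdorff_dist_triangle:
  fixes A C E :: "'a::heine_borel set"
  assumes "compact A" "A \<noteq> {}" "compact C" "C \<noteq> {}" "compact E" "E \<noteq> {}"
  shows "hausdorff_dist A E \<le> hausdorff_dist A C + hausdorff_dist C E"
  unfolding hausdorff_dist_le_iff[OF assms(1,2,5,6)]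
proof (intro conjI ballI)
  fix a assume "a \<in> A"
  then show "infdist a E \<le> hausdorff_dist A C + hausdorff_dist C E"
    using infdist_le_infdist_plus_hausdorff_dist[OF assms(3-6), of a]
      infdist_le_hausdorff_dist[OF assms(1,3,4)] by fastforce
next
  fix e assume "e \<in> E"
  then show "infdist e A \<le> hausdorff_dist A C + hausdorff_dist C E"
    using infdist_le_infdist_plus_hausdorff_dist[OF assms(3,4,1,2), of e]
      infdist_le_hausdorff_dist[OF assms(5,3,4), of e]
      hausdorff_dist_commute[of A C] hausdorff_dist_commute[of C E] by fastforce
qed

section \<open>Limits of sequences of compact sets\<close>

lemma tendsto_infdist_hausdorff:
  fixes A :: "nat \<Rightarrow> 'a::heine_borel set"
  assumes A: "\<And>n. compact (A n)" "\<And>n. A n \<noteq> {}" and K: "compact K" "K \<noteq> {}"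
    and lim: "(\<lambda>n. hausdorff_dist (A n) K) \<longlonglongrightarrow> 0"
  shows "(\<lambda>n. infdist x (A n)) \<longlonglongrightarrow> infdist x K"
proof -
  have "norm (infdist x (A n) - infdist x K) \<le> hausdorff_dist (A n) K" for n
    using infdist_le_infdist_plus_hausdorff_dist[OF A(1)[of n] A(2)[of n] K, of x]
      infdist_le_infdist_plus_hausdorff_dist[OF K A(1)[of n] A(2)[of n], of x]
      hausdorff_dist_commute[of "A n" K] by simp
  then have "(\<lambda>n. infdist x (A n) - infdist x K) \<longlonglongrightarrow> 0"
    using lim by (intro Lim_null_comparison[OF _ lim]) auto
  then show ?thesis using LIM_zero_iff by blast
qed

text \<open>The distance functions of the sets are 1-Lipschitz, so Arzela--Ascoli provides a uniform
  limit \<open>g\<close> along a subsequence; its zero set is the limit of the sets.\<close>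

theorem Blaschke_selection:
  fixes A :: "nat \<Rightarrow> 'a::euclidean_space set"
  assumes B: "compact B" and A: "\<And>n. compact (A n)" "\<And>n. A n \<noteq> {}" "\<And>n. A n \<subseteq> B"
  obtains K r where "compact K" "K \<noteq> {}" "K \<subseteq> B" "strict_mono (r :: nat \<Rightarrow> nat)"
    "(\<lambda>n. hausdorff_dist (A (r n)) K) \<longlonglongrightarrow> 0"
proof -
  \<comment> \<open>Uniform boundedness for Arzela-Ascoli: \<open>A n\<close> contains a point of
    \<open>B\<close>, and points of \<open>B\<close> are at most \<open>diameter B\<close>
    apart.\<close>
  have bound: "norm (infdist x (A n)) \<le> diameter B" if "x \<in> B" for x n
  proof -
    obtain a where "a \<in> A n" using A(2) by blast
    then have "infdist x (A n) \<le> dist x a" "a \<in> B"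
      using A(3) by (auto intro: infdist_le)
    then show ?thesis
      using diameter_bounded_bound[OF compact_imp_bounded[OF B] that \<open>a \<in> B\<close>]
      by (simp add: infdist_nonneg)
  qed
  have equi: "\<exists>d. 0 < d \<and> (\<forall>n y. y \<in> B \<and> norm (x - y) < d
                \<longrightarrow> norm (infdist x (A n) - infdist y (A n)) < e)" if "0 < e" for x e
    using that infdist_triangle_abs[of x _]
    by (intro exI[of _ e]) (auto simp: dist_norm intro: le_less_trans)
  obtain g r where g: "continuous_on B g" and r: "strict_mono (r :: nat \<Rightarrow> nat)"
    and unif: "\<And>e. 0 < e \<Longrightarrow> \<exists>N. \<forall>n x. n \<ge> N \<and> x \<in> B \<longrightarrow> norm (infdist x (A (r n)) - g x) < e"
    using Arzela_Ascoli[OF B bound equi] by metis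
  \<comment> \<open>The distance to \<open>A (r n)\<close> vanishes on \<open>A (r n)\<close>
    itself, so uniform convergence makes \<open>g\<close> small there.\<close>
  have g_small: "\<exists>N. \<forall>n\<ge>N. \<forall>x\<in>A (r n). g x < e" if e: "0 < e" for e
  proof -
    obtain N where N: "\<And>n x. n \<ge> N \<Longrightarrow> x \<in> B \<Longrightarrow> \<bar>infdist x (A (r n)) - g x\<bar> < e"
      using unif[OF e] by auto
    have "g x < e" if "n \<ge> N" "x \<in> A (r n)" for n x
      using N[OF that(1), of x] that(2) A(3)[of "r n"] by auto
    then show ?thesis by blast
  qed
  \<comment> \<open>As a limit of distances \<open>g\<close> is non-negative; on a non-empty compact
    set without zeros it attains a positive minimum.\<close>
  have g_pos: "\<exists>e>0. \<forall>x\<in>C. e \<le> g x" if "closed C" "C \<subseteq> B" "\<forall>x\<in>C. g x \<noteq> 0" for C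
  proof (cases "C = {}")
    case False
    have nonneg: "0 \<le> g x" if "x \<in> B" for x
    proof (rule ccontr)
      assume "\<not> 0 \<le> g x"
      then obtain N where "norm (infdist x (A (r N)) - g x) < - g x"
        using unif[of "- g x"] \<open>x \<in> B\<close> by auto
      then show False using infdist_nonneg[of x "A (r N)"] by simp
    qed
    have "compact C"
      using that B compact_Int_closed[of B C] by (simp add: Int_absorb1)
    moreover have "continuous_on C g"
      using g that continuous_on_subset by blast
    ultimately obtain c where c: "c \<in> C" "\<And>x. x \<in> C \<Longrightarrow> g c \<le> g x"
      using continuous_attains_inf[of C g] False by blast
    then have "0 < g c"
      using nonneg[of c] that by fastforce
    then show ?thesis using c by blast
  qed (auto intro: exI[of _ 1])
  define K where "K = {x \<in> B. g x = 0}"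
  have "closed K"
    unfolding K_def using continuous_closed_preimage_constant[OF g compact_imp_closed[OF B]] .
  have "K \<subseteq> B" by (auto simp: K_def)
  have "compact K"
    using B \<open>closed K\<close> \<open>K \<subseteq> B\<close> compact_Int_closed[of B K] by (simp add: Int_absorb1)
  have "K \<noteq> {}"
  \<comment> \<open>Without zeros \<open>g\<close> would be bounded away from 0 on all of
    \<open>B\<close>, yet it is eventually small on the non-empty sets
    \<open>A (r n)\<close>.\<close>
  proof
    assume "K = {}"
    then obtain e where e: "e > 0" "\<forall>x\<in>B. e \<le> g x"
      using g_pos[of B] B by (auto simp: K_def compact_imp_closed)
    then obtain N where "\<forall>x\<in>A (r N). g x < e" using g_small by blast
    then show False using e A(2)[of "r N"] A(3)[of "r N"] by fastforce
  qed
  have "(\<lambda>n. hausdorff_dist (A (r n)) K) \<longlonglongrightarrow> 0"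
  proof (rule LIMSEQ_I)
    fix e :: real assume "0 < e"
    \<comment> \<open>Half of \<open>e\<close>, so that the non-strict bound by \<open>d\<close>
      gives the strict one by \<open>e\<close>.\<close>
    define d where "d = e / 2"
    have d: "0 < d" "d < e" using \<open>0 < e\<close> by (auto simp: d_def)
    \<comment> \<open>On the points of \<open>B\<close> at distance at least \<open>d\<close> from
      \<open>K\<close>, \<open>g\<close> has a positive lower bound. Late sets
      \<open>A (r n)\<close>, where \<open>g\<close> is smaller than that, avoid \<open>C\<close>
      and so stay within \<open>d\<close> of \<open>K\<close>.\<close>
    define C where "C = B \<inter> {x. d \<le> infdist x K}"
    have "closed {x. d \<le> infdist x K}"
      by (intro closed_Collect_le continuous_intros)
    then have "closed C"
      unfolding C_def using closed_Int[OF compact_imp_closed[OF B]] by blast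
    moreover have "g x \<noteq> 0" if "x \<in> C" for x
    proof
      assume "g x = 0"
      then have "infdist x K = 0" using that by (simp add: K_def C_def)
      then show False using that d by (simp add: C_def)
    qed
    ultimately obtain e' where e': "0 < e'" "\<forall>x\<in>C. e' \<le> g x"
      using g_pos[of C] by (auto simp: C_def)
    obtain N1 where N1: "\<forall>n\<ge>N1. \<forall>x\<in>A (r n). g x < e'"
      using g_small e' by blast
    obtain N2 where N2: "\<forall>n x. n \<ge> N2 \<and> x \<in> B \<longrightarrow> norm (infdist x (A (r n)) - g x) < d"
      using unif d by blast
    have "hausdorff_dist (A (r n)) K \<le> d" if "n \<ge> max N1 N2" for n
      unfolding hausdorff_dist_le_iff[OF A(1,2) \<open>compact K\<close> \<open>K \<noteq> {}\<close>]
    proof (intro conjI ballI)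
      fix x assume x: "x \<in> A (r n)"
      then have "g x < e'" using N1 that by auto
      then have "x \<notin> C" using e' by force
      then show "infdist x K \<le> d" using x A(3)[of "r n"] by (auto simp: C_def)
    next
      \<comment> \<open>Conversely, on \<open>K\<close> the distances to \<open>A (r n)\<close> tend
        uniformly to \<open>g x = 0\<close>.\<close>
      fix x assume "x \<in> K"
      then have "x \<in> B" "g x = 0" by (auto simp: K_def)
      then have "norm (infdist x (A (r n)) - 0) < d" using N2 that by fastforce
      then show "infdist x (A (r n)) \<le> d" by simp
    qed
    then have "norm (hausdorff_dist (A (r n)) K - 0) < e" if "n \<ge> max N1 N2" for n
      using d(2) that hausdorff_dist_nonneg[of "A (r n)" K] by fastforce
    then show "\<exists>N. \<forall>n\<ge>N. norm (hausdorff_dist (A (r n)) K - 0) < e" by blast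
  qed
  then show ?thesis
    using that \<open>compact K\<close> \<open>K \<noteq> {}\<close> \<open>K \<subseteq> B\<close> r by blast
qed

section \<open>Hypographs of upper semicontinuous functions\<close>

text \<open>Replaces the extended-real \<open>Limsup\<close> by a neighbourhood condition over real
  bounds \<open>z\<close>; an infinite bound is trivial.\<close>

lemma usc_on_iff:
  "usc_on S f \<longleftrightarrow> (\<forall>x0\<in>S. \<forall>z>f x0. \<exists>d>0. \<forall>x\<in>S. dist x x0 < d \<longrightarrow> f x < z)"
proof -
  have "Limsup (at x0 within S) (\<lambda>x. ereal (f x)) \<le> ereal (f x0) \<longleftrightarrow>
        (\<forall>z>f x0. eventually (\<lambda>x. f x < z) (at x0 within S))" (is "?L \<longleftrightarrow> ?R") for x0
  proof
    assume ?L
    then have "\<forall>\<^sub>F x in at x0 within S. ereal (f x) < ereal z" if "f x0 < z" for z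
      using that unfolding Limsup_le_iff by (metis less_ereal.simps(1))
    then show ?R by simp
  next
    assume R: ?R
    show ?L unfolding Limsup_le_iff
    proof (intro allI impI)
      fix y assume "ereal (f x0) < y"
      then show "\<forall>\<^sub>F x in at x0 within S. ereal (f x) < y"
        using R by (cases y) auto
    qed
  qed
  \<comment> \<open>The filter omits \<open>x0\<close> while the right-hand side includes it;
    \<open>f x0 < z\<close> covers that point.\<close>
  moreover have "(\<forall>\<^sub>F x in at x0 within S. f x < z) =
      (\<exists>d>0. \<forall>x\<in>S. dist x x0 < d \<longrightarrow> f x < z)" if "f x0 < z" for x0 z
    using that unfolding eventually_at by metis
  ultimately have "Limsup (at x0 within S) (\<lambda>x. ereal (f x)) \<le> ereal (f x0) \<longleftrightarrow>
      (\<forall>z>f x0. \<exists>d>0. \<forall>x\<in>S. dist x x0 < d \<longrightarrow> f x < z)" for x0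
    by (simp only: cong: imp_cong)
  then show ?thesis
    by (simp only: usc_on_def)
qed

text \<open>Each \<open>x\<close> has a ball on which \<open>f\<close> stays below
  \<open>f x + 1\<close>; finitely many of these balls cover \<open>S\<close>.\<close>

lemma usc_on_compact_bounded_above:
  assumes "compact S" "usc_on S f"
  shows "\<exists>M. \<forall>x\<in>S. f x \<le> M"
proof -
  have "\<exists>d>0. \<forall>y\<in>S. dist y x < d \<longrightarrow> f y < f x + 1" if "x \<in> S" for x
    using assms(2) that unfolding usc_on_iff by (metis less_add_one)
  then obtain d where d: "\<And>x. x \<in> S \<Longrightarrow> d x > 0"
      "\<And>x y. x \<in> S \<Longrightarrow> y \<in> S \<Longrightarrow> dist y x < d x \<Longrightarrow> f y < f x + 1"
    by metis
  have "S \<subseteq> (\<Union>x\<in>S. ball x (d x))" using d by force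
  then obtain T where T: "T \<subseteq> S" "finite T" "S \<subseteq> (\<Union>x\<in>T. ball x (d x))"
    using compactE_image[OF assms(1), of S "\<lambda>x. ball x (d x)"] by auto
  have "f y \<le> Max ((\<lambda>x. f x + 1) ` T)" if y: "y \<in> S" for y
  proof -
    obtain x where x: "x \<in> T" "dist x y < d x" using T y by auto
    then have "f y \<le> f x + 1" using d(2)[of x y] T y by (auto simp: dist_commute)
    also have "\<dots> \<le> Max ((\<lambda>x. f x + 1) ` T)" using x T by (intro Max_ge) auto
    finally show ?thesis .
  qed
  then show ?thesis by blast
qed

lemma mem_hypograph_iff: "(x, y) \<in> hypograph f \<longleftrightarrow> x \<in> {0..1} \<and> 0 \<le> y \<and> y \<le> f x"
  by (simp add: hypograph_def)

text \<open>If a limit point \<open>(x, y)\<close> lay above the graph, some \<open>z\<close>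
  strictly between \<open>f x\<close> and \<open>y\<close> would bound \<open>f\<close> near
  \<open>x\<close>, while the heights of the approximating points eventually exceed
  \<open>z\<close>.\<close>

lemma closed_hypograph:
  assumes "usc_on {0..1} f"
  shows "closed (hypograph f)"
proof (unfold closed_sequential_limits, intro allI impI, elim conjE)
  fix p :: "nat \<Rightarrow> real \<times> real" and l
  assume p: "\<forall>n. p n \<in> hypograph f" and lim: "p \<longlonglongrightarrow> l"
  obtain x y where l: "l = (x, y)" by force
  have lim1: "(\<lambda>n. fst (p n)) \<longlonglongrightarrow> x" and lim2: "(\<lambda>n. snd (p n)) \<longlonglongrightarrow> y"
    using tendsto_fst[OF lim] tendsto_snd[OF lim] l by auto
  have p': "fst (p n) \<in> {0..1}" "0 \<le> snd (p n)" "snd (p n) \<le> f (fst (p n))" for n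
    using p mem_hypograph_iff[of "fst (p n)" "snd (p n)" f] by auto
  have x: "x \<in> {0..1}"
    using closed_sequentially[OF _ _ lim1, of "{0..1}"] p' by auto
  have "0 \<le> y"
    using p' by (intro LIMSEQ_le_const[OF lim2]) auto
  moreover have "y \<le> f x"
  proof (rule ccontr)
    assume "\<not> y \<le> f x"
    then obtain z where z: "f x < z" "z < y" using dense[of "f x" y] by auto
    obtain d where d: "d > 0" "\<forall>u\<in>{0..1}. dist u x < d \<longrightarrow> f u < z"
      using assms x z unfolding usc_on_iff by blast
    have "eventually (\<lambda>n. dist (fst (p n)) x < d) sequentially"
      using tendstoD[OF lim1 d(1)] .
    moreover have "eventually (\<lambda>n. z < snd (p n)) sequentially"
      using order_tendstoD(1)[OF lim2 z(2)] .
    ultimately have "eventually (\<lambda>n. False) sequentially"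
    proof eventually_elim
      case (elim n)
      then show ?case using d p'[of n] by force
    qed
    then show False by simp
  qed
  ultimately show "l \<in> hypograph f" using x l by (simp add: mem_hypograph_iff)
qed

lemma hypograph_subset:
  assumes "\<And>x. x \<in> {0..1} \<Longrightarrow> f x \<le> M"
  shows "hypograph f \<subseteq> {0..1} \<times> {0..M}"
proof
  fix p assume "p \<in> hypograph f"
  then show "p \<in> {0..1} \<times> {0..M}"
    using assms[of "fst p"] by (cases p) (simp add: mem_hypograph_iff)
qed

lemma compact_hypograph:
  assumes "f \<in> USC"
  shows "compact (hypograph f)"
proof -
  have f: "usc_on {0..1} f" using assms by (simp add: USC_def)
  then obtain M where M: "\<And>x. x \<in> {0..1} \<Longrightarrow> f x \<le> M"
    using usc_on_compact_bounded_above by (metis compact_Icc)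
  have "compact ({0..1::real} \<times> {0..M})" by (intro compact_Times compact_Icc)
  moreover have "hypograph f = ({0..1} \<times> {0..M}) \<inter> hypograph f"
    using hypograph_subset[of f M] M by blast
  ultimately show ?thesis
    using closed_hypograph[OF f] compact_Int_closed by metis
qed

lemma USC_nonneg: "f \<in> USC \<Longrightarrow> x \<in> {0..1} \<Longrightarrow> 0 \<le> f x"
  by (auto simp: USC_def PiE_iff)

lemma zero_mem_hypograph: "f \<in> USC \<Longrightarrow> x \<in> {0..1} \<Longrightarrow> (x, 0) \<in> hypograph f"
  using USC_nonneg by (simp add: mem_hypograph_iff)

lemma graph_mem_hypograph: "f \<in> USC \<Longrightarrow> x \<in> {0..1} \<Longrightarrow> (x, f x) \<in> hypograph f"
  using USC_nonneg by (simp add: mem_hypograph_iff)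

lemma hypograph_nonempty: "f \<in> USC \<Longrightarrow> hypograph f \<noteq> {}"
  using zero_mem_hypograph[of f 0] by auto

text \<open>The value \<open>f x\<close> is the greatest height over \<open>x\<close>;
  extensionality settles the arguments outside the unit interval.\<close>

lemma inj_on_hypograph: "inj_on hypograph USC"
proof (rule inj_onI)
  fix f g assume fg: "f \<in> USC" "g \<in> USC" "hypograph f = hypograph g"
  have "f \<in> extensional {0..1}" "g \<in> extensional {0..1}"
    using fg by (auto simp: USC_def PiE_iff)
  moreover have "f x = g x" if "x \<in> {0..1}" for x
    using graph_mem_hypograph[OF fg(1) that] graph_mem_hypograph[OF fg(2) that] fg(3)
    by (metis antisym mem_hypograph_iff)
  ultimately show "f = g" by (rule extensionalityI)
qed

text \<open>Take the top of each vertical slice of \<open>K\<close>: slices are compact, and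
  non-empty by \<open>base\<close>. Closure under moving down makes \<open>K\<close> the whole
  hypograph, and closedness of \<open>K\<close> gives semicontinuity.\<close>

lemma ex_USC_hypograph_eq:
  assumes K: "compact K" "K \<subseteq> {0..1} \<times> {0..}"
    and base: "\<And>x. x \<in> {0..1} \<Longrightarrow> (x, 0) \<in> K"
    and down: "\<And>x y y'. (x, y) \<in> K \<Longrightarrow> 0 \<le> y' \<Longrightarrow> y' \<le> y \<Longrightarrow> (x, y') \<in> K"
  shows "\<exists>f\<in>USC. hypograph f = K"
proof -
  have "\<exists>m. (x, m) \<in> K \<and> (\<forall>y. (x, y) \<in> K \<longrightarrow> y \<le> m)" if "x \<in> {0..1}" for x
  proof -
    have "compact (snd ` (K \<inter> {x} \<times> UNIV))"
      using K(1) by (intro compact_continuous_image continuous_intros compact_Int_closed closed_Times) auto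
    moreover have "snd ` (K \<inter> {x} \<times> UNIV) \<noteq> {}" using base that by blast
    ultimately obtain m where "m \<in> snd ` (K \<inter> {x} \<times> UNIV)" "\<forall>y\<in>snd ` (K \<inter> {x} \<times> UNIV). y \<le> m"
      using compact_attains_sup by blast
    then show ?thesis by force
  qed
  then obtain h where h: "\<And>x. x \<in> {0..1} \<Longrightarrow> (x, h x) \<in> K"
      "\<And>x y. x \<in> {0..1} \<Longrightarrow> (x, y) \<in> K \<Longrightarrow> y \<le> h x"
    by metis
  define f where "f = restrict h {0..1}"
  have hyp: "hypograph f = K"
  proof (intro set_eqI iffI)
    fix p assume "p \<in> hypograph f"
    then show "p \<in> K"
      using down[OF h(1)] by (cases p) (auto simp: hypograph_def f_def)
  next
    fix p assume p: "p \<in> K"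
    then show "p \<in> hypograph f"
      using h(2) K(2) by (cases p) (auto simp: hypograph_def f_def)
  qed
  have "usc_on {0..1} f"
    unfolding usc_on_iff
  proof (intro ballI allI impI)
    fix x0 z assume x0: "x0 \<in> {0..1::real}" and z: "f x0 < z"
    have "0 \<le> f x0" using h(2)[OF x0 base[OF x0]] x0 by (simp add: f_def)
    then have "0 \<le> z" using z by simp
    \<comment> \<open>The set of \<open>x\<close> with \<open>(x, z)\<close> in \<open>K\<close> is
      closed and misses \<open>x0\<close>, hence misses a ball around it. A value \<open>f x\<close>
      of at least \<open>z\<close> in that ball would put \<open>(x, z)\<close> in \<open>K\<close>
      by \<open>down\<close>, as \<open>z\<close> is non-negative.\<close>
    have "closed ((\<lambda>x. (x, z)) -` K)"
      using K(1) by (intro continuous_closed_vimage compact_imp_closed continuous_intros)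
    moreover have "x0 \<notin> (\<lambda>x. (x, z)) -` K"
      using h(2) x0 z by (force simp: f_def)
    ultimately obtain d where d: "d > 0" "ball x0 d \<subseteq> - ((\<lambda>x. (x, z)) -` K)"
      using open_contains_ball[of "- ((\<lambda>x. (x, z)) -` K)"] by (metis ComplI open_Compl)
    have "f x < z" if "x \<in> {0..1}" "dist x x0 < d" for x
    proof (rule ccontr)
      assume "\<not> f x < z"
      then have "(x, z) \<in> K" using down[of x "h x" z] h(1) that \<open>0 \<le> z\<close> by (simp add: f_def)
      then show False using d that by (auto simp: dist_commute)
    qed
    then show "\<exists>d>0. \<forall>x\<in>{0..1}. dist x x0 < d \<longrightarrow> f x < z" using d by blast
  qed
  moreover have "0 \<le> h x" if "x \<in> {0..1}" for x
    using h(2)[OF that base[OF that]] .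
  then have "f \<in> {0..1} \<rightarrow>\<^sub>E {0..}"
    by (simp add: f_def PiE_iff)
  ultimately show ?thesis using hyp by (auto simp: USC_def)
qed

text \<open>Lower a nearest point \<open>(a, b)\<close> to height \<open>min b y'\<close>: it stays
  in the hypograph, and its vertical gap to \<open>y'\<close> is at most that between
  \<open>b\<close> and \<open>y\<close>. This puts closure under moving down into a form that
  survives limits.\<close>

lemma infdist_hypograph_mono:
  assumes f: "f \<in> USC" and y: "0 \<le> y'" "y' \<le> y"
  shows "infdist (x, y') (hypograph f) \<le> infdist (x, y) (hypograph f)"
proof -
  obtain p where p: "p \<in> hypograph f" "infdist (x, y) (hypograph f) = dist (x, y) p"
    using infdist_attains_inf compact_imp_closed compact_hypograph hypograph_nonempty f by metis
  obtain a b where ab: "p = (a, b)" by force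
  have "(a, min b y') \<in> hypograph f"
    using p(1) y by (auto simp: ab mem_hypograph_iff)
  then have "infdist (x, y') (hypograph f) \<le> dist (x, y') (a, min b y')"
    by (rule infdist_le)
  also have "\<dots> \<le> dist (x, y) (a, b)"
    using y by (auto simp: dist_Pair_Pair dist_real_def intro!: real_sqrt_le_mono add_left_mono power_mono
        simp flip: abs_le_square_iff)
  finally show ?thesis using p ab by simp
qed

section \<open>The metric space of upper semicontinuous functions\<close>

lemma Metric_space_USC: "Metric_space USC hypo_dist"
proof
  show "hypo_dist f g = 0 \<longleftrightarrow> f = g" if "f \<in> USC" "g \<in> USC" for f g
    using that inj_on_hypograph
    by (simp add: hypo_dist_def hausdorff_dist_eq_0_iff compact_hypograph hypograph_nonempty inj_on_eq_iff)
  show "hypo_dist f h \<le> hypo_dist f g + hypo_dist g h" if "f \<in> USC" "g \<in> USC" "h \<in> USC" for f g h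
    using that by (simp add: hypo_dist_def hausdorff_dist_triangle compact_hypograph hypograph_nonempty)
\<comment> \<open>Non-negativity and symmetry are required on the whole type, including functions
  outside \<open>USC\<close>.\<close>
qed (auto simp: hypo_dist_def hausdorff_dist_nonneg hausdorff_dist_commute)

interpretation USC: Metric_space USC hypo_dist
  by (rule Metric_space_USC)

lemma USC_bounded_convergent_subsequence:
  assumes F: "\<And>n. F n \<in> USC" and M: "\<And>n x. x \<in> {0..1} \<Longrightarrow> F n x \<le> M"
  obtains f r where "f \<in> USC" "strict_mono (r :: nat \<Rightarrow> nat)"
    "(\<lambda>n. hypo_dist (F (r n)) f) \<longlonglongrightarrow> 0"
proof -
  have hyp: "\<And>n. compact (hypograph (F n))" "\<And>n. hypograph (F n) \<noteq> {}"
    using F compact_hypograph hypograph_nonempty by blast+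
  obtain K r where K: "compact K" "K \<noteq> {}" "K \<subseteq> {0..1} \<times> {0..M}"
    and r: "strict_mono (r :: nat \<Rightarrow> nat)"
    and lim: "(\<lambda>n. hausdorff_dist (hypograph (F (r n))) K) \<longlonglongrightarrow> 0"
    using Blaschke_selection[of "{0..1} \<times> {0..M}" "\<lambda>n. hypograph (F n)"]
      hyp hypograph_subset M compact_Times compact_Icc by metis
  have inf: "(\<lambda>n. infdist p (hypograph (F (r n)))) \<longlonglongrightarrow> infdist p K" for p
    using tendsto_infdist_hausdorff[OF hyp K(1,2) lim] .
  \<comment> \<open>Membership in the closed set \<open>K\<close> means distance 0, so equalities
    and inequalities for distances to the hypographs pass to \<open>K\<close>.\<close>
  have mem: "p \<in> K \<longleftrightarrow> infdist p K = 0" for p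
    using in_closed_iff_infdist_zero[OF compact_imp_closed[OF K(1)] K(2)] .
  have "(x, 0) \<in> K" if "x \<in> {0..1}" for x
  proof -
    have "(\<lambda>n. 0) \<longlonglongrightarrow> infdist (x, 0) K"
      using inf[of "(x, 0)"] zero_mem_hypograph[OF F that] by simp
    then show ?thesis using LIMSEQ_unique mem tendsto_const by metis
  qed
  moreover have "(x, y') \<in> K" if "(x, y) \<in> K" "0 \<le> y'" "y' \<le> y" for x y y'
  proof -
    have "infdist (x, y') K \<le> infdist (x, y) K"
      using infdist_hypograph_mono[OF F that(2,3)] by (intro LIMSEQ_le[OF inf inf]) auto
    then show ?thesis
      using that(1) mem infdist_nonneg antisym by metis
  qed
  moreover have "K \<subseteq> {0..1} \<times> {0..}" using K(3) by auto
  ultimately obtain f where "f \<in> USC" "hypograph f = K"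
    using ex_USC_hypograph_eq[OF K(1)] by metis
  then show ?thesis
    using that r lim by (simp add: hypo_dist_def)
qed

section \<open>Maxima of upper semicontinuous functions\<close>

text \<open>The height function attains its maximum on the compact hypograph, and the base
  coordinate of such a top point maximises \<open>f\<close>.\<close>

lemma maximum_USC:
  assumes "f \<in> USC"
  shows "maximum (f ` {0..1}) \<in> f ` {0..1}" "x \<in> {0..1} \<Longrightarrow> f x \<le> maximum (f ` {0..1})"
proof -
  have "continuous_on (hypograph f) snd" by (intro continuous_intros)
  then obtain p where p: "p \<in> hypograph f" "\<forall>q\<in>hypograph f. snd q \<le> snd p"
    using continuous_attains_sup[OF compact_hypograph[OF assms] hypograph_nonempty[OF assms]] by blast
  then have fst: "fst p \<in> {0..1}" "snd p \<le> f (fst p)"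
    using mem_hypograph_iff[of "fst p" "snd p" f] by auto
  have le: "f x \<le> f (fst p)" if "x \<in> {0..1}" for x
    using graph_mem_hypograph[OF assms that] p fst by force
  then have "maximum (f ` {0..1}) = f (fst p)"
    using fst by (intro maximum_eqI) auto
  then show "maximum (f ` {0..1}) \<in> f ` {0..1}"
    "x \<in> {0..1} \<Longrightarrow> f x \<le> maximum (f ` {0..1})"
    using fst le by auto
qed

text \<open>Start from a highest graph point of \<open>f\<close>. Its nearest point in the hypograph
  of \<open>g\<close> is lower by at most the distance and no higher than the maximum of
  \<open>g\<close>.\<close>

lemma maximum_le_hypo_dist:
  assumes "f \<in> USC" "g \<in> USC"
  shows "maximum (f ` {0..1}) \<le> maximum (g ` {0..1}) + hypo_dist f g"
proof -
  obtain x where x: "x \<in> {0..1}" "maximum (f ` {0..1}) = f x"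
    using maximum_USC(1)[OF assms(1)] by blast
  obtain q where q: "q \<in> hypograph g" "infdist (x, f x) (hypograph g) = dist (x, f x) q"
    using infdist_attains_inf compact_imp_closed compact_hypograph hypograph_nonempty assms by metis
  have "f x - snd q \<le> dist (x, f x) q"
    using dist_snd_le[of "(x, f x)" q] by (simp add: dist_real_def)
  also have "\<dots> \<le> hypo_dist f g"
    using infdist_le_hausdorff_dist[OF compact_hypograph[OF assms(1)] compact_hypograph[OF assms(2)]
        hypograph_nonempty[OF assms(2)] graph_mem_hypograph[OF assms(1) x(1)]] q
    by (simp add: hypo_dist_def)
  finally have "f x \<le> snd q + hypo_dist f g" by simp
  moreover have "snd q \<le> maximum (g ` {0..1})"
    using q(1) mem_hypograph_iff[of "fst q" "snd q" g] maximum_USC(2)[OF assms(2), of "fst q"] by auto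
  ultimately show ?thesis using x by simp
qed

section \<open>Bounded sets, completeness and compactness\<close>

lemma USC_mbounded_imp_bounded:
  assumes "USC.mbounded S"
  shows "\<exists>M. \<forall>f\<in>S. \<forall>x\<in>{0..1}. f x \<le> M"
proof -
  obtain c B where S: "S \<subseteq> USC.mcball c B"
    using assms unfolding USC.mbounded_def by blast
  have "f x \<le> maximum (c ` {0..1}) + B" if "f \<in> S" "x \<in> {0..1}" for f x
  proof -
    have "f \<in> USC.mcball c B" using S that(1) by blast
    then have f: "f \<in> USC" "c \<in> USC" "hypo_dist f c \<le> B"
      using USC.commute[of f c] by simp_all
    show ?thesis
      using maximum_USC(2)[OF f(1) that(2)] maximum_le_hypo_dist[OF f(1,2)] f(3) by simp
  qed
  then show ?thesis by blast
qed

lemma USC_mbounded_convergent_subsequence: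
  assumes "USC.mbounded (range \<sigma>)"
  obtains l r where "strict_mono (r :: nat \<Rightarrow> nat)" "limitin USC.mtopology (\<sigma> \<circ> r) l sequentially"
proof -
  obtain M where M: "\<And>n x. x \<in> {0..1} \<Longrightarrow> \<sigma> n x \<le> M"
    using USC_mbounded_imp_bounded[OF assms] by blast
  have \<sigma>: "\<sigma> n \<in> USC" for n
    using USC.mbounded_subset_mspace[OF assms] by blast
  obtain f r where "f \<in> USC" "strict_mono (r :: nat \<Rightarrow> nat)" "(\<lambda>n. hypo_dist (\<sigma> (r n)) f) \<longlonglongrightarrow> 0"
    using M by (rule USC_bounded_convergent_subsequence[of \<sigma> M, OF \<sigma>])
  then show ?thesis
    using that \<sigma> by (auto simp: USC.limitin_metric_dist_null o_def)
qed

text \<open>A Cauchy sequence is bounded, so some subsequence converges, and then the whole sequence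
  does.\<close>

lemma USC_mcomplete: "USC.mcomplete"
  unfolding USC.mcomplete_def
proof (intro allI impI)
  fix \<sigma> assume \<sigma>: "USC.MCauchy \<sigma>"
  show "\<exists>x. limitin USC.mtopology \<sigma> x sequentially"
    using USC_mbounded_convergent_subsequence[OF USC.MCauchy_imp_mbounded[OF \<sigma>]]
      USC.MCauchy_convergent_subsequence[OF \<sigma>] by metis
qed

lemma USC_compactin:
  assumes "USC.mbounded S" "closedin USC.mtopology S"
  shows "compactin USC.mtopology S"
  unfolding USC.compactin_sequentially
proof (intro conjI allI impI)
  show "S \<subseteq> USC" using assms(1) USC.mbounded_subset_mspace by blast
  fix \<sigma> :: "nat \<Rightarrow> real \<Rightarrow> real" assume \<sigma>: "range \<sigma> \<subseteq> S"
  obtain l r where lr: "strict_mono (r :: nat \<Rightarrow> nat)"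
      "limitin USC.mtopology (\<sigma> \<circ> r) l sequentially"
    using USC_mbounded_convergent_subsequence USC.mbounded_subset[OF assms(1) \<sigma>] by blast
  \<comment> \<open>Closedness keeps the subsequential limit in \<open>S\<close>.\<close>
  then have "l \<in> S"
    using limitin_closedin[OF lr(2) assms(2)] \<sigma> by (simp add: image_subset_iff)
  then show "\<exists>l r. l \<in> S \<and> strict_mono r \<and> limitin USC.mtopology (\<sigma> \<circ> r) l sequentially"
    using lr by blast
qed

section \<open>Proper metric spaces\<close>

lemma (in Metric_space) proper_imp_locally_compact_space:
  assumes "\<And>x r. compactin mtopology (mcball x r)"
  shows "locally_compact_space mtopology"
  unfolding locally_compact_space_def
proof
  fix x assume "x \<in> topspace mtopology"
  then have "x \<in> mball x 1" by simp
  then show "\<exists>U K. openin mtopology U \<and> compactin mtopology K \<and> x \<in> U \<and> U \<subseteq> K"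
    using assms by (intro exI[of _ "mball x 1"] exI[of _ "mcball x 1"]) auto
qed

text \<open>A proper metric space is a countable union of totally bounded balls \<open>mcball a k\<close>.\<close>

lemma (in Metric_space) proper_imp_separable_space:
  assumes "\<And>x r. compactin mtopology (mcball x r)"
  shows "separable_space mtopology"
proof (cases "M = {}")
  case False
  then obtain a where a: "a \<in> M" by blast
  have "\<exists>N. finite N \<and> N \<subseteq> M \<and> mcball a (real k) \<subseteq> (\<Union>x\<in>N. mball x (inverse (real (Suc n))))" for k n
  proof -
    have "mtotally_bounded (mcball a (real k))"
      using assms by (rule compactin_imp_mtotally_bounded)
    moreover have "0 < inverse (real (Suc n))" by simp
    ultimately obtain N where "finite N" "N \<subseteq> mcball a (real k)"
        "mcball a (real k) \<subseteq> (\<Union>x\<in>N. mball x (inverse (real (Suc n))))"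
      unfolding mtotally_bounded_def by metis
    then show ?thesis using mcball_subset_mspace[of a "real k"] by (intro exI[of _ N]) blast
  qed
  then obtain N where N: "\<And>k n. finite (N k n)" "\<And>k n. N k n \<subseteq> M"
      "\<And>k n. mcball a (real k) \<subseteq> (\<Union>x\<in>N k n. mball x (inverse (real (Suc n))))"
    by metis
  \<comment> \<open>Finite nets for all integer radii \<open>k\<close> and all accuracies
    \<open>1 / (n + 1)\<close> together form a countable set.\<close>
  define D where "D = (\<Union>k n. N k n)"
  have "countable D"
    unfolding D_def using N(1) by (intro countable_UN countableI_type countable_finite)
  moreover have "D \<subseteq> M" using N(2) by (auto simp: D_def)
  moreover have "mtopology closure_of D = M"
    unfolding metric_closure_of
  proof (intro set_eqI iffI CollectI conjI allI impI)
    fix x e assume x: "x \<in> M" and "0 < (e::real)"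
    \<comment> \<open>Choose \<open>n\<close> for the accuracy \<open>e\<close>, then
      \<open>k\<close> so that the ball around \<open>a\<close> contains \<open>x\<close>.\<close>
    then obtain n where n: "inverse (real (Suc n)) < e" using reals_Archimedean by blast
    obtain k where "d a x \<le> real k" using real_arch_simple by blast
    then have "x \<in> mcball a (real k)" using a x by simp
    then obtain y where "y \<in> N k n" "x \<in> mball y (inverse (real (Suc n)))" using N(3) by blast
    then show "\<exists>y\<in>D. y \<in> mball x e"
      using n by (intro bexI[of _ y]) (auto simp: D_def commute)
  qed auto
  ultimately show ?thesis unfolding separable_space_def by auto
next
  case True
  then show ?thesis
    unfolding separable_space_def
    by (metis topspace_mtopology closure_of_empty countable_empty empty_subsetI)
qed

theorem theorem1:
  shows "(Metric_space USC hypo_dist \<and>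
          Metric_space.mcomplete USC hypo_dist \<and>
          separable_space (Metric_space.mtopology USC hypo_dist) \<and>
          (\<forall>S. S \<subseteq> USC \<and> Metric_space.mbounded USC hypo_dist S \<and>
               closedin (Metric_space.mtopology USC hypo_dist) S
               \<longrightarrow> compactin (Metric_space.mtopology USC hypo_dist) S) \<and>
          locally_compact_space (Metric_space.mtopology USC hypo_dist))
       \<and>
         (\<forall>f F. f \<in> USC \<and> (\<forall>n\<ge>1. F n \<in> USC) \<and>
                (\<lambda>n::nat. hypo_dist (F n) f) \<longlonglongrightarrow> 0
                \<longrightarrow> (\<lambda>n. maximum (F n ` {0..1})) \<longlonglongrightarrow> maximum (f ` {0..1}))"
proof (intro conjI allI impI)
  \<comment> \<open>Closed balls are bounded and closed, hence compact; local compactness and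
    separability both follow from this.\<close>
  have mcball: "compactin USC.mtopology (USC.mcball f e)" for f e
    using USC_compactin USC.mbounded_mcball USC.closedin_mcball by blast
  show "locally_compact_space USC.mtopology"
    using mcball by (rule USC.proper_imp_locally_compact_space)
  show "separable_space USC.mtopology"
    using mcball by (rule USC.proper_imp_separable_space)
  show "compactin USC.mtopology S"
    if "S \<subseteq> USC \<and> USC.mbounded S \<and> closedin USC.mtopology S" for S
    using that USC_compactin by blast
next
  fix f and F :: "nat \<Rightarrow> real \<Rightarrow> real"
  assume asm: "f \<in> USC \<and> (\<forall>n\<ge>1. F n \<in> USC) \<and> (\<lambda>n. hypo_dist (F n) f) \<longlonglongrightarrow> 0"
  \<comment> \<open>Apply the Lipschitz bound in both directions. Since \<open>F 0\<close> may lie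
    outside \<open>USC\<close>, the estimate is claimed only from index 1 on, which suffices for the
    limit.\<close>
  have "norm (maximum (F n ` {0..1}) - maximum (f ` {0..1})) \<le> hypo_dist (F n) f" if "n \<ge> 1" for n
    using asm that maximum_le_hypo_dist[of f "F n"] maximum_le_hypo_dist[of "F n" f]
      USC.commute[of f "F n"] by (simp add: abs_le_iff)
  then have "\<forall>\<^sub>F n in sequentially.
      norm (maximum (F n ` {0..1}) - maximum (f ` {0..1})) \<le> hypo_dist (F n) f"
    by (rule eventually_sequentiallyI)
  moreover have "(\<lambda>n. hypo_dist (F n) f) \<longlonglongrightarrow> 0"
    using asm by simp
  ultimately have "(\<lambda>n. maximum (F n ` {0..1}) - maximum (f ` {0..1})) \<longlonglongrightarrow> 0"
    by (rule Lim_null_comparison)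
  then show "(\<lambda>n. maximum (F n ` {0..1})) \<longlonglongrightarrow> maximum (f ` {0..1})"
    using LIM_zero_iff by blast
qed (rule Metric_space_USC USC_mcomplete)+

end
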